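(* Let $K$ be an algebraic function field over a field $k$ and let $V$ be a valuation ring of $K$ with maximal ideal $m_V$. Consider directed systems $\{R_i\mid i\in I\}$ of normal local rings such that (a) $V=\bigcup_{i\in I}R_i$; (b) $I$ has a minimum $0$; (c) each $R_i$ is essentially of finite type over $k$ and has quotient field $K$; (d) if $i<j$ then $R_j$ dominates $R_i$. Then the ring $T=\bigcup_{i\in I}\hat R_i$ is independent of the choice of directed system $\{R_i\mid i\in I\}$ satisfying (a), (b), (c) and (d).
   Context: $\hat R$ denotes the completion of a local ring $R$ at its maximal ideal $m_R$. For local rings $R\subset S$, $S$ dominates $R$ if $m_S\cap R=m_R$. All $R_i$ are dominated by $V$. Whenever $R\subset S$ are normal local rings, essentially of finite type over $k$, with quotient field $K$, and $S$ dominates $R$, the induced map $\hat R\to\hat S$ is injective (Zariski's subspace theorem), so $\{\hat R_i\}$ is a directed system with inclusions as transition maps and $T=\bigcup_i\hat R_i$ is its direct limit. Independence means: if $\{S_j\mid j\in J\}$ is another system satisfying (a)-(d), then $\bigcup_{i\in I}\hat R_i=\bigcup_{j\in J}\hat S_j$, identified through the natural inclusions $\hat R_i\subset\hat S_j$ and $\hat S_j\subset\hat R_i$ coming from inclusions $R_i\subset S_j$ and $S_j\subset R_i$. *)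

theory Defs
  imports "HOL-Algebra.Algebra"
begin

section \<open>Subrings of a field\<close>

definition function_field :: "('a, 'b) ring_scheme \<Rightarrow> 'a set \<Rightarrow> bool"
  where "function_field K k \<longleftrightarrow>
    field K \<and> subfield k K \<and>
    (\<exists>A. finite A \<and> A \<subseteq> carrier K \<and> generate_field K (k \<union> A) = carrier K)"

definition valuation_ring :: "('a, 'b) ring_scheme \<Rightarrow> 'a set \<Rightarrow> bool"
  where "valuation_ring K V \<longleftrightarrow>
    subring V K \<and> (\<forall>x \<in> carrier K - {\<zero>\<^bsub>K\<^esub>}. x \<in> V \<or> inv\<^bsub>K\<^esub> x \<in> V)"

definition quotient_field :: "('a, 'b) ring_scheme \<Rightarrow> 'a set \<Rightarrow> 'a set"
  where "quotient_field K A =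
    {a \<otimes>\<^bsub>K\<^esub> inv\<^bsub>K\<^esub> b | a b. a \<in> A \<and> b \<in> A - {\<zero>\<^bsub>K\<^esub>}}"

text \<open>Polynomials are lists with the leading coefficient first; the zero polynomial is the empty
  list.\<close>

definition integral_over :: "('a, 'b) ring_scheme \<Rightarrow> 'a set \<Rightarrow> 'a \<Rightarrow> bool"
  where "integral_over K A x \<longleftrightarrow>
    (\<exists>p \<in> carrier (A [X]\<^bsub>K\<^esub>). p \<noteq> [] \<and> lead_coeff p = \<one>\<^bsub>K\<^esub> \<and> ring.eval K p x = \<zero>\<^bsub>K\<^esub>)"

definition normal_subring :: "('a, 'b) ring_scheme \<Rightarrow> 'a set \<Rightarrow> bool"
  where "normal_subring K A \<longleftrightarrow>
    subring A K \<and> (\<forall>x \<in> quotient_field K A. integral_over K A x \<longrightarrow> x \<in> A)"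

text \<open>A subring of \<^term>\<open>K\<close> is essentially of finite type over \<^term>\<open>k\<close> if it is a localization
  of a finitely generated \<^term>\<open>k\<close>-subalgebra at a multiplicative set. Replacing an
  abstract finitely generated algebra by its image in \<^term>\<open>K\<close> loses nothing.\<close>

definition ess_finite_type :: "('a, 'b) ring_scheme \<Rightarrow> 'a set \<Rightarrow> 'a set \<Rightarrow> bool"
  where "ess_finite_type K k A \<longleftrightarrow>
    (\<exists>F W. finite F \<and> F \<subseteq> carrier K \<and>
       submonoid W K \<and> W \<subseteq> generate_ring K (k \<union> F) - {\<zero>\<^bsub>K\<^esub>} \<and>
       A = {b \<otimes>\<^bsub>K\<^esub> inv\<^bsub>K\<^esub> w | b w. b \<in> generate_ring K (k \<union> F) \<and> w \<in> W})"

definition local_ring :: "('a, 'b) ring_scheme \<Rightarrow> bool"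
  where "local_ring R \<longleftrightarrow> cring R \<and> (\<exists>!m. maximalideal m R)"

definition max_ideal :: "('a, 'b) ring_scheme \<Rightarrow> 'a set"
  where "max_ideal R = (THE m. maximalideal m R)"

definition dominates :: "('a, 'b) ring_scheme \<Rightarrow> 'a set \<Rightarrow> 'a set \<Rightarrow> bool"
  where "dominates K B A \<longleftrightarrow>
    A \<subseteq> B \<and> max_ideal (K\<lparr>carrier := B\<rparr>) \<inter> A = max_ideal (K\<lparr>carrier := A\<rparr>)"


section \<open>Completion of a local ring at its maximal ideal\<close>

primrec ideal_power :: "('a, 'b) ring_scheme \<Rightarrow> 'a set \<Rightarrow> nat \<Rightarrow> 'a set"
  where
    "ideal_power R m 0 = carrier R"
  | "ideal_power R m (Suc n) = ideal_power R m n \<cdot>\<^bsub>R\<^esub> m"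

abbreviation max_power :: "('a, 'b) ring_scheme \<Rightarrow> nat \<Rightarrow> 'a set"
  where "max_power R n \<equiv> ideal_power R (max_ideal R) n"

text \<open>The completion is the inverse limit of the rings \<open>R / m\<^sup>n\<close>. Its elements are sequences of
  cosets, and the projection from \<open>R / m\<^sup>n\<^sup>+\<^sup>1\<close> to \<open>R / m\<^sup>n\<close> sends a coset \<open>C\<close> to \<open>C + m\<^sup>n\<close>.\<close>

definition completion :: "('a, 'b) ring_scheme \<Rightarrow> (nat \<Rightarrow> 'a set) ring"
  where "completion R =
    \<lparr>carrier = {x. \<forall>n. x n \<in> carrier (R Quot max_power R n) \<and>
                       x (Suc n) <+>\<^bsub>R\<^esub> max_power R n = x n},
     monoid.mult = (\<lambda>x y n. x n \<otimes>\<^bsub>R Quot max_power R n\<^esub> y n),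
     one = (\<lambda>n. \<one>\<^bsub>R Quot max_power R n\<^esub>),
     ring.zero = (\<lambda>n. \<zero>\<^bsub>R Quot max_power R n\<^esub>),
     add = (\<lambda>x y n. x n \<oplus>\<^bsub>R Quot max_power R n\<^esub> y n)\<rparr>"

text \<open>For a local ring \<open>S\<close> dominating \<open>R\<close>, the map of completions induced by the inclusion of \<open>R\<close>
  in \<open>S\<close> sends the class of \<open>a\<close> modulo \<open>m\<^sub>R\<^sup>n\<close> to its class modulo \<open>m\<^sub>S\<^sup>n\<close>; it depends only
  on \<open>S\<close>.\<close>

definition completion_map :: "('a, 'b) ring_scheme \<Rightarrow> (nat \<Rightarrow> 'a set) \<Rightarrow> (nat \<Rightarrow> 'a set)"
  where "completion_map S x = (\<lambda>n. x n <+>\<^bsub>S\<^esub> max_power S n)"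


section \<open>Direct limits of rings\<close>

text \<open>In the following, \<open>f i j\<close> is the transition map from \<open>G i\<close> to \<open>G j\<close>; only its values for
  \<open>i \<le> j\<close> matter. Elements of the limit are equivalence classes of pairs \<open>(i, x)\<close> with
  \<open>x\<close> in \<open>G i\<close>, two pairs being identified if they become equal further up.\<close>

definition limit_map ::
    "'i::order set \<Rightarrow> ('i \<Rightarrow> ('c, 'd) ring_scheme) \<Rightarrow> ('i \<Rightarrow> 'i \<Rightarrow> 'c \<Rightarrow> 'c) \<Rightarrow> 'i \<Rightarrow> 'c \<Rightarrow> ('i \<times> 'c) set"
  where "limit_map I G f i x =
    {(j, y). j \<in> I \<and> y \<in> carrier (G j) \<and> (\<exists>l \<in> I. i \<le> l \<and> j \<le> l \<and> f i l x = f j l y)}"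

text \<open>The operations are computed at a common upper index. Each union below ranges over copies of a
  single class, since the result does not depend on the chosen indices and representatives.\<close>

definition direct_limit ::
    "'i::order set \<Rightarrow> ('i \<Rightarrow> ('c, 'd) ring_scheme) \<Rightarrow> ('i \<Rightarrow> 'i \<Rightarrow> 'c \<Rightarrow> 'c) \<Rightarrow> ('i \<times> 'c) set ring"
  where "direct_limit I G f =
    \<lparr>carrier = {limit_map I G f i x | i x. i \<in> I \<and> x \<in> carrier (G i)},
     monoid.mult = (\<lambda>a b. \<Union> {limit_map I G f l (f i l x \<otimes>\<^bsub>G l\<^esub> f j l y) | i x j y l.
                        (i, x) \<in> a \<and> (j, y) \<in> b \<and> l \<in> I \<and> i \<le> l \<and> j \<le> l}),
     one = (\<Union>i \<in> I. limit_map I G f i \<one>\<^bsub>G i\<^esub>),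
     ring.zero = (\<Union>i \<in> I. limit_map I G f i \<zero>\<^bsub>G i\<^esub>),
     add = (\<lambda>a b. \<Union> {limit_map I G f l (f i l x \<oplus>\<^bsub>G l\<^esub> f j l y) | i x j y l.
                        (i, x) \<in> a \<and> (j, y) \<in> b \<and> l \<in> I \<and> i \<le> l \<and> j \<le> l})\<rparr>"


section \<open>Directed systems of normal local rings with union a valuation ring\<close>

definition normal_local_system ::
    "('a, 'b) ring_scheme \<Rightarrow> 'a set \<Rightarrow> 'a set \<Rightarrow> 'i::order set \<Rightarrow> ('i \<Rightarrow> 'a set) \<Rightarrow> bool"
  where "normal_local_system K k V I R \<longleftrightarrow>
    (\<forall>i \<in> I. \<forall>j \<in> I. \<exists>l \<in> I. i \<le> l \<and> j \<le> l) \<and>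
    (\<forall>i \<in> I. normal_subring K (R i) \<and> local_ring (K\<lparr>carrier := R i\<rparr>)) \<and>
    V = (\<Union>i \<in> I. R i) \<and>
    (\<exists>z \<in> I. \<forall>i \<in> I. z \<le> i) \<and>
    (\<forall>i \<in> I. ess_finite_type K k (R i) \<and> quotient_field K (R i) = carrier K) \<and>
    (\<forall>i \<in> I. \<forall>j \<in> I. i < j \<longrightarrow> dominates K (R j) (R i))"

abbreviation completion_of :: "('a, 'b) ring_scheme \<Rightarrow> 'a set \<Rightarrow> (nat \<Rightarrow> 'a set) ring"
  where "completion_of K A \<equiv> completion (K\<lparr>carrier := A\<rparr>)"

abbreviation completion_of_map ::
    "('a, 'b) ring_scheme \<Rightarrow> 'a set \<Rightarrow> (nat \<Rightarrow> 'a set) \<Rightarrow> (nat \<Rightarrow> 'a set)"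
  where "completion_of_map K B \<equiv> completion_map (K\<lparr>carrier := B\<rparr>)"

text \<open>The union of the completions of the rings \<open>R i\<close>, and the inclusions of these completions.\<close>

definition completion_union ::
    "('a, 'b) ring_scheme \<Rightarrow> 'i::order set \<Rightarrow> ('i \<Rightarrow> 'a set) \<Rightarrow> ('i \<times> (nat \<Rightarrow> 'a set)) set ring"
  where "completion_union K I R =
    direct_limit I (\<lambda>i. completion_of K (R i)) (\<lambda>i j. completion_of_map K (R j))"

definition completion_incl ::
    "('a, 'b) ring_scheme \<Rightarrow> 'i::order set \<Rightarrow> ('i \<Rightarrow> 'a set) \<Rightarrow> 'i \<Rightarrow> (nat \<Rightarrow> 'a set)
      \<Rightarrow> ('i \<times> (nat \<Rightarrow> 'a set)) set"
  where "completion_incl K I R =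
    limit_map I (\<lambda>i. completion_of K (R i)) (\<lambda>i j. completion_of_map K (R j))"

end

theory Submission
  imports Defs
begin

text \<open>
  Two systems with the same union \<open>V\<close> are cofinal in each other, and a union of a directed system
  does not change under passage between cofinal systems.

  Cofinality rests on two facts. A ring \<open>A\<close> that is essentially of finite type is determined by
  finitely many generators together with inverses of some elements of \<open>A\<close> that are already
  polynomials in these generators (lemma \<open>ess_finite_type_generators\<close>). Moreover, domination of
  local rings means that no non-unit of the smaller ring becomes a unit of the larger one
  (\<open>dominates_iff_units\<close>), so passing to the union of a system shows that an element of \<open>R\<^sub>i\<close>
  which is invertible in \<open>V\<close> is invertible in \<open>R\<^sub>i\<close> already (\<open>system_Units\<close>). If now \<open>R\<close> and \<open>S\<close>
  are two systems, then some \<open>S\<^sub>j\<close> contains the finitely many generators of \<open>R\<^sub>i\<close>. The denominators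
  occurring in \<open>R\<^sub>i\<close> are in \<open>S\<^sub>j\<close> and invertible in \<open>R\<^sub>i \<subseteq> V\<close>, hence invertible in \<open>S\<^sub>j\<close>; therefore
  \<open>R\<^sub>i \<subseteq> S\<^sub>j\<close>. For the same reason \<open>S\<^sub>j\<close> dominates \<open>R\<^sub>i\<close>, since a unit of \<open>S\<^sub>j\<close> lying in \<open>R\<^sub>i\<close> is a
  unit of \<open>V\<close> (\<open>systems_dominates\<close>, \<open>systems_cofinal\<close>).

  Completion is functorial for domination: writing an element of the completion of \<open>A\<close> as the
  sequence of the cosets \<open>m\<^sub>A\<^sup>n + a\<^sub>n\<close>, the induced map keeps the representatives \<open>a\<^sub>n\<close> and replaces
  \<open>m\<^sub>A\<close> by the maximal ideal of the larger ring. Hence the maps between the completions of the \<open>R\<^sub>i\<close>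
  and the \<open>S\<^sub>j\<close>, in both directions, compose to the transition maps of the two systems. Such
  an interleaving of two directed systems induces mutually inverse maps of the limits
  (\<open>interleaved_limits_isomorphic\<close>).
\<close>

section \<open>Direct limits of rings\<close>

text \<open>Closure of the \<open>G i\<close> under the operations is what well-definedness of the operations of the
  limit requires.\<close>

locale direct_system =
  fixes I :: "'i::order set" and G :: "'i \<Rightarrow> ('c, 'd) ring_scheme" and f :: "'i \<Rightarrow> 'i \<Rightarrow> 'c \<Rightarrow> 'c"
  assumes nonempty: "I \<noteq> {}"
    and upper_bound: "\<lbrakk>i \<in> I; j \<in> I\<rbrakk> \<Longrightarrow> \<exists>l \<in> I. i \<le> l \<and> j \<le> l"
    and mult_closed: "\<lbrakk>i \<in> I; x \<in> carrier (G i); y \<in> carrier (G i)\<rbrakk> \<Longrightarrow> x \<otimes>\<^bsub>G i\<^esub> y \<in> carrier (G i)"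
    and add_closed: "\<lbrakk>i \<in> I; x \<in> carrier (G i); y \<in> carrier (G i)\<rbrakk> \<Longrightarrow> x \<oplus>\<^bsub>G i\<^esub> y \<in> carrier (G i)"
    and one_closed: "i \<in> I \<Longrightarrow> \<one>\<^bsub>G i\<^esub> \<in> carrier (G i)"
    and hom: "\<lbrakk>i \<in> I; j \<in> I; i \<le> j\<rbrakk> \<Longrightarrow> f i j \<in> ring_hom (G i) (G j)"
    and map_id: "\<lbrakk>i \<in> I; x \<in> carrier (G i)\<rbrakk> \<Longrightarrow> f i i x = x"
    and map_trans: "\<lbrakk>i \<in> I; j \<in> I; l \<in> I; i \<le> j; j \<le> l; x \<in> carrier (G i)\<rbrakk>
      \<Longrightarrow> f j l (f i j x) = f i l x"
begin

abbreviation L where "L \<equiv> direct_limit I G f"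
abbreviation incl where "incl \<equiv> limit_map I G f"

lemma map_closed: "\<lbrakk>i \<in> I; j \<in> I; i \<le> j; x \<in> carrier (G i)\<rbrakk> \<Longrightarrow> f i j x \<in> carrier (G j)"
  using hom by (rule ring_hom_closed)

lemma carrier_limit: "carrier L = {incl i x | i x. i \<in> I \<and> x \<in> carrier (G i)}"
  by (simp add: direct_limit_def)

lemma in_incl: "\<lbrakk>i \<in> I; x \<in> carrier (G i)\<rbrakk> \<Longrightarrow> (i, x) \<in> incl i x"
  unfolding limit_map_def by auto

text \<open>If \<open>x\<close> and \<open>y\<close> agree at \<open>l\<close>, and \<open>x\<close> and \<open>z\<close> agree at \<open>q\<close>, then all three agree at any index
  above \<open>l\<close> and \<open>q\<close>. This is the transitivity of the relation whose classes form the limit.\<close>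

lemma incl_subsetI:
  assumes "i \<in> I" "j \<in> I" "l \<in> I" "i \<le> l" "j \<le> l" "x \<in> carrier (G i)" "y \<in> carrier (G j)"
    and eq: "f i l x = f j l y"
  shows "incl i x \<subseteq> incl j y"
proof clarify
  fix p z assume "(p, z) \<in> incl i x"
  then obtain q where q: "p \<in> I" "z \<in> carrier (G p)" "q \<in> I" "i \<le> q" "p \<le> q" "f i q x = f p q z"
    unfolding limit_map_def by auto
  obtain r where r: "r \<in> I" "l \<le> r" "q \<le> r"
    using upper_bound assms(3) q(3) by blast
  have "f j r y = f l r (f j l y)" using map_trans[of j l r y] assms r by auto
  also have "\<dots> = f i r x" using map_trans[of i l r x] assms(1-7) r by (simp flip: eq)
  also have "\<dots> = f q r (f i q x)" using map_trans[of i q r x] assms q r by auto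
  also have "\<dots> = f p r z" using map_trans[of p q r z] q r by auto
  finally show "(p, z) \<in> incl j y"
    unfolding limit_map_def using q r assms by (auto intro!: bexI[of _ r])
qed

lemma incl_eqI:
  assumes "i \<in> I" "j \<in> I" "l \<in> I" "i \<le> l" "j \<le> l" "x \<in> carrier (G i)" "y \<in> carrier (G j)"
    and "f i l x = f j l y"
  shows "incl i x = incl j y"
  using incl_subsetI[OF assms] incl_subsetI[OF assms(2,1,3,5,4,7,6) assms(8)[symmetric]]
  by (rule equalityI)

lemma incl_eqD:
  assumes "i \<in> I" "j \<in> I" "x \<in> carrier (G i)" "y \<in> carrier (G j)" "incl i x = incl j y"
  shows "\<exists>l \<in> I. i \<le> l \<and> j \<le> l \<and> f i l x = f j l y"
proof -
  have "(j, y) \<in> incl i x" using assms in_incl by simp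
  then show ?thesis unfolding limit_map_def by auto
qed

lemma mem_inclD:
  assumes "i \<in> I" "x \<in> carrier (G i)" "(j, y) \<in> incl i x"
  shows "j \<in> I" "y \<in> carrier (G j)" "incl j y = incl i x"
proof -
  obtain l where "j \<in> I" "y \<in> carrier (G j)" "l \<in> I" "i \<le> l" "j \<le> l" "f i l x = f j l y"
    using assms(3) unfolding limit_map_def by auto
  then show "j \<in> I" "y \<in> carrier (G j)" "incl j y = incl i x"
    using assms incl_eqI[of i j l x y] by simp_all
qed

lemma incl_map:
  assumes "i \<in> I" "j \<in> I" "i \<le> j" "x \<in> carrier (G i)"
  shows "incl j (f i j x) = incl i x"
  using assms map_closed map_id by (intro incl_eqI[of j i j]) auto

text \<open>Addition and multiplication of the limit are both given by a family of binary operations that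
  commute with the transition maps; for such a family the result does not depend on the
  representatives, nor on the index at which they are combined.\<close>

lemma Union_operation:
  assumes op_closed: "\<And>i x y. \<lbrakk>i \<in> I; x \<in> carrier (G i); y \<in> carrier (G i)\<rbrakk> \<Longrightarrow> op i x y \<in> carrier (G i)"
    and op_map: "\<And>i j x y. \<lbrakk>i \<in> I; j \<in> I; i \<le> j; x \<in> carrier (G i); y \<in> carrier (G i)\<rbrakk>
      \<Longrightarrow> f i j (op i x y) = op j (f i j x) (f i j y)"
    and p: "p \<in> I" "u \<in> carrier (G p)" and q: "q \<in> I" "v \<in> carrier (G q)"
    and l: "l \<in> I" "p \<le> l" "q \<le> l"
  shows "\<Union> {incl l (op l (f i l x) (f j l y)) | i x j y l.
      (i, x) \<in> incl p u \<and> (j, y) \<in> incl q v \<and> l \<in> I \<and> i \<le> l \<and> j \<le> l}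
    = incl l (op l (f p l u) (f q l v))" (is "\<Union> ?C = ?c")
proof -
  \<comment> \<open>The result may be computed at any larger index; so two results are compared at an index at
    which the representatives of both factors agree.\<close>
  have push: "incl l (op l (f i l x) (f j l y)) = incl m (op m (f i m x) (f j m y))"
    if "i \<in> I" "x \<in> carrier (G i)" "j \<in> I" "y \<in> carrier (G j)" "l \<in> I" "i \<le> l" "j \<le> l"
      "m \<in> I" "l \<le> m" for i x j y l m
    using that incl_map[of l m "op l (f i l x) (f j l y)"]
    by (simp add: op_closed op_map map_closed map_trans)
  have same: "incl l' (op l' (f i l' x) (f j l' y)) = ?c"
    if i: "(i, x) \<in> incl p u" and j: "(j, y) \<in> incl q v" and l': "l' \<in> I" "i \<le> l'" "j \<le> l'"
    for i x j y l'
  proof -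
    note i' = mem_inclD[OF p i] and j' = mem_inclD[OF q j]
    obtain a where a: "a \<in> I" "i \<le> a" "p \<le> a" "f i a x = f p a u"
      using incl_eqD[OF i'(1) p(1) i'(2) p(2) i'(3)] by auto
    obtain b where b: "b \<in> I" "j \<le> b" "q \<le> b" "f j b y = f q b v"
      using incl_eqD[OF j'(1) q(1) j'(2) q(2) j'(3)] by auto
    obtain c where c: "c \<in> I" "a \<le> c" "b \<le> c" using upper_bound a b by blast
    obtain d where d: "d \<in> I" "l \<le> d" "l' \<le> d" using upper_bound l l' by blast
    obtain m where m: "m \<in> I" "c \<le> m" "d \<le> m" using upper_bound c d by blast
    have "f i m x = f p m u"
      using map_trans[of i a m x] map_trans[of p a m u] a c m i' p by auto
    moreover have "f j m y = f q m v"
      using map_trans[of j b m y] map_trans[of q b m v] b c m j' q by auto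
    ultimately show ?thesis
      using push[of i x j y l' m] push[of p u q v l m] i' j' p q l l' d m by auto
  qed
  have "?c \<in> ?C" using in_incl[OF p] in_incl[OF q] l by blast
  moreover have "c = ?c" if "c \<in> ?C" for c using that same by auto
  ultimately have "?C = {?c}" by blast
  then show ?thesis by simp
qed

lemma limit_mult:
  assumes "p \<in> I" "u \<in> carrier (G p)" "q \<in> I" "v \<in> carrier (G q)" "l \<in> I" "p \<le> l" "q \<le> l"
  shows "incl p u \<otimes>\<^bsub>L\<^esub> incl q v = incl l (f p l u \<otimes>\<^bsub>G l\<^esub> f q l v)"
  using Union_operation[of "\<lambda>i. monoid.mult (G i)" p u q v l] assms mult_closed ring_hom_mult[OF hom]
  by (simp add: direct_limit_def)

lemma limit_add:
  assumes "p \<in> I" "u \<in> carrier (G p)" "q \<in> I" "v \<in> carrier (G q)" "l \<in> I" "p \<le> l" "q \<le> l"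
  shows "incl p u \<oplus>\<^bsub>L\<^esub> incl q v = incl l (f p l u \<oplus>\<^bsub>G l\<^esub> f q l v)"
  using Union_operation[of "\<lambda>i. add (G i)" p u q v l] assms add_closed ring_hom_add[OF hom]
  by (simp add: direct_limit_def)

lemma limit_one:
  assumes "i \<in> I"
  shows "\<one>\<^bsub>L\<^esub> = incl i \<one>\<^bsub>G i\<^esub>"
proof -
  have "incl j \<one>\<^bsub>G j\<^esub> = incl i \<one>\<^bsub>G i\<^esub>" if j: "j \<in> I" for j
  proof -
    obtain l where l: "l \<in> I" "i \<le> l" "j \<le> l" using upper_bound assms j by blast
    then show ?thesis
      using assms j one_closed ring_hom_one[OF hom]
      by (intro incl_eqI[of j i l]) auto
  qed
  then have "(\<Union>j \<in> I. incl j \<one>\<^bsub>G j\<^esub>) = incl i \<one>\<^bsub>G i\<^esub>"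
    using nonempty by (intro SUP_eq_const)
  then show ?thesis by (simp add: direct_limit_def)
qed

lemma incl_hom:
  assumes "i \<in> I"
  shows "incl i \<in> ring_hom (G i) L"
  using assms
  by (intro ring_hom_memI)
    (auto simp: carrier_limit limit_mult[of _ _ _ _ i] limit_add[of _ _ _ _ i] limit_one[of i] map_id)

text \<open>The map out of the limit evaluates a compatible family at a chosen representative of each
  class; two representatives agree further up, where compatibility gives them the same value.\<close>

lemma universal_property:
  assumes hom_\<psi>: "\<And>i. i \<in> I \<Longrightarrow> \<psi> i \<in> ring_hom (G i) T"
    and compatible: "\<And>i j x. \<lbrakk>i \<in> I; j \<in> I; i \<le> j; x \<in> carrier (G i)\<rbrakk> \<Longrightarrow> \<psi> j (f i j x) = \<psi> i x"
  obtains h where "h \<in> ring_hom L T"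
    and "\<And>i x. \<lbrakk>i \<in> I; x \<in> carrier (G i)\<rbrakk> \<Longrightarrow> h (incl i x) = \<psi> i x"
proof
  define h where "h c = (let (i, x) = (SOME p. p \<in> c) in \<psi> i x)" for c
  show h: "h (incl i x) = \<psi> i x" if "i \<in> I" "x \<in> carrier (G i)" for i x
  proof -
    obtain j y where jy: "(SOME p. p \<in> incl i x) = (j, y)" by fastforce
    have mem: "(j, y) \<in> incl i x" using in_incl[OF that] unfolding jy[symmetric] by (rule someI)
    note j = mem_inclD[OF that mem]
    obtain l where "l \<in> I" "i \<le> l" "j \<le> l" "f i l x = f j l y"
      using mem unfolding limit_map_def by auto
    then have "\<psi> j y = \<psi> i x" using compatible[of i l x] compatible[of j l y] that j by auto
    then show ?thesis by (simp add: h_def jy)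
  qed
  obtain i0 where i0: "i0 \<in> I" using nonempty by blast
  have ops: "h (a \<otimes>\<^bsub>L\<^esub> b) = h a \<otimes>\<^bsub>T\<^esub> h b \<and> h (a \<oplus>\<^bsub>L\<^esub> b) = h a \<oplus>\<^bsub>T\<^esub> h b"
    if ab: "a \<in> carrier L" "b \<in> carrier L" for a b
  proof -
    obtain i x where a: "a = incl i x" "i \<in> I" "x \<in> carrier (G i)" using ab carrier_limit by auto
    obtain j y where b: "b = incl j y" "j \<in> I" "y \<in> carrier (G j)" using ab carrier_limit by auto
    obtain l where l: "l \<in> I" "i \<le> l" "j \<le> l" using upper_bound a b by blast
    show ?thesis
      using a b l
      by (simp add: limit_mult[of i x j y l] limit_add[of i x j y l] h map_closed mult_closed
          add_closed ring_hom_mult[OF hom_\<psi>] ring_hom_add[OF hom_\<psi>] compatible)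
  qed
  show "h \<in> ring_hom L T"
  proof (rule ring_hom_memI)
    show "h c \<in> carrier T" if "c \<in> carrier L" for c
      using that ring_hom_closed[OF hom_\<psi>] by (auto simp: carrier_limit h)
    show "h \<one>\<^bsub>L\<^esub> = \<one>\<^bsub>T\<^esub>"
      using i0 ring_hom_one[OF hom_\<psi>] by (simp add: limit_one[of i0] h one_closed)
  qed (use ops in auto)
qed

end

text \<open>The relations \<open>P i j\<close> and \<open>Q j i\<close> say that a map from \<open>G i\<close> to \<open>H j\<close>, respectively from \<open>H j\<close>
  to \<open>G i\<close>, is available. The map of limits sends the class of \<open>x\<close> at \<open>i\<close> to the class of \<open>u i j x\<close>
  at any index \<open>j\<close> that \<open>i\<close> maps to. Its bijectivity comes from going back with \<open>v\<close>: a round trip is a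
  transition map, which the limit does not see.\<close>

theorem interleaved_limits_isomorphic:
  fixes G :: "'i::order \<Rightarrow> ('c, 'd) ring_scheme" and H :: "'j::order \<Rightarrow> ('e, 'g) ring_scheme"
  assumes G: "direct_system I G f" and H: "direct_system J H g"
    and u_hom: "\<And>i j. \<lbrakk>i \<in> I; j \<in> J; P i j\<rbrakk> \<Longrightarrow> u i j \<in> ring_hom (G i) (H j)"
    and v_hom: "\<And>j i. \<lbrakk>j \<in> J; i \<in> I; Q j i\<rbrakk> \<Longrightarrow> v j i \<in> ring_hom (H j) (G i)"
    and P_ex: "\<And>i. i \<in> I \<Longrightarrow> \<exists>j \<in> J. P i j"
    and Q_ex: "\<And>j. j \<in> J \<Longrightarrow> \<exists>i \<in> I. Q j i"
    and P_up: "\<And>i j l. \<lbrakk>i \<in> I; j \<in> J; l \<in> J; P i j; j \<le> l\<rbrakk> \<Longrightarrow> P i l"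
    and P_down: "\<And>i m j. \<lbrakk>i \<in> I; m \<in> I; j \<in> J; P m j; i \<le> m\<rbrakk> \<Longrightarrow> P i j"
    and Q_up: "\<And>j i m. \<lbrakk>j \<in> J; i \<in> I; m \<in> I; Q j i; i \<le> m\<rbrakk> \<Longrightarrow> Q j m"
    and g_u: "\<And>i j l x. \<lbrakk>i \<in> I; j \<in> J; l \<in> J; P i j; j \<le> l; x \<in> carrier (G i)\<rbrakk> \<Longrightarrow> g j l (u i j x) = u i l x"
    and u_f: "\<And>i m j x. \<lbrakk>i \<in> I; m \<in> I; j \<in> J; P m j; i \<le> m; x \<in> carrier (G i)\<rbrakk> \<Longrightarrow> u m j (f i m x) = u i j x"
    and v_u: "\<And>i j m x. \<lbrakk>i \<in> I; j \<in> J; m \<in> I; P i j; Q j m; i \<le> m; x \<in> carrier (G i)\<rbrakk> \<Longrightarrow> v j m (u i j x) = f i m x"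
    and u_v: "\<And>j i l y. \<lbrakk>j \<in> J; i \<in> I; l \<in> J; Q j i; P i l; j \<le> l; y \<in> carrier (H j)\<rbrakk> \<Longrightarrow> u i l (v j i y) = g j l y"
  shows "\<exists>\<phi> \<in> ring_iso (direct_limit I G f) (direct_limit J H g).
    (\<forall>i \<in> I. \<forall>j \<in> J. P i j \<longrightarrow> (\<forall>x \<in> carrier (G i).
       \<phi> (limit_map I G f i x) = limit_map J H g j (u i j x))) \<and>
    (\<forall>i \<in> I. \<forall>j \<in> J. Q j i \<longrightarrow> (\<forall>y \<in> carrier (H j).
       \<phi> (limit_map I G f i (v j i y)) = limit_map J H g j y))"
proof -
  interpret G: direct_system I G f by (rule G)
  interpret H: direct_system J H g by (rule H)
  obtain c where c: "\<And>i. i \<in> I \<Longrightarrow> c i \<in> J \<and> P i (c i)" using P_ex by metis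
  have u_closed: "u i j x \<in> carrier (H j)" if "i \<in> I" "j \<in> J" "P i j" "x \<in> carrier (G i)" for i j x
    using that u_hom by (metis ring_hom_closed)
  have v_closed: "v j i y \<in> carrier (G i)" if "i \<in> I" "j \<in> J" "Q j i" "y \<in> carrier (H j)" for i j y
    using that v_hom by (metis ring_hom_closed)
  have indep: "H.incl j (u i j x) = H.incl l (u i l x)"
    if i: "i \<in> I" "x \<in> carrier (G i)" and j: "j \<in> J" "P i j" and l: "l \<in> J" "P i l" for i j l x
  proof -
    obtain m where m: "m \<in> J" "j \<le> m" "l \<le> m" using H.upper_bound j l by blast
    then show ?thesis
      using i j l by (intro H.incl_eqI[of j l m]) (auto simp: g_u u_closed)
  qed
  obtain \<phi> where \<phi>_hom: "\<phi> \<in> ring_hom G.L H.L"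
    and \<phi>_c: "\<And>i x. \<lbrakk>i \<in> I; x \<in> carrier (G i)\<rbrakk> \<Longrightarrow> \<phi> (G.incl i x) = (H.incl (c i) \<circ> u i (c i)) x"
  proof (rule G.universal_property)
    show "H.incl (c i) \<circ> u i (c i) \<in> ring_hom (G i) H.L" if "i \<in> I" for i
      using c[OF that] that u_hom H.incl_hom by (metis ring_hom_trans)
    show "(H.incl (c j) \<circ> u j (c j)) (f i j x) = (H.incl (c i) \<circ> u i (c i)) x"
      if "i \<in> I" "j \<in> I" "i \<le> j" "x \<in> carrier (G i)" for i j x
      using that c[of i] c[of j] P_down[of i j "c j"] indep[of i x "c j" "c i"] by (simp add: u_f)
  qed (rule that; simp)
  have \<phi>_u: "\<phi> (G.incl i x) = H.incl j (u i j x)"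
    if "i \<in> I" "j \<in> J" "P i j" "x \<in> carrier (G i)" for i j x
    using that \<phi>_c[of i x] indep[of i x "c i" j] c[of i] by simp
  have \<phi>_v: "\<phi> (G.incl i (v j i y)) = H.incl j y"
    if i: "i \<in> I" and j: "j \<in> J" and Q: "Q j i" and y: "y \<in> carrier (H j)" for i j y
  proof -
    obtain l where l: "l \<in> J" "c i \<le> l" "j \<le> l" using H.upper_bound c[OF i] j by blast
    then have "P i l" using P_up[of i "c i" l] c i by blast
    then have "\<phi> (G.incl i (v j i y)) = H.incl l (g j l y)"
      using \<phi>_u[of i l "v j i y"] u_v[of j i l y] v_closed i j l Q y by simp
    then show ?thesis using H.incl_map j l y by simp
  qed
  have "inj_on \<phi> (carrier G.L)"
  proof (rule inj_onI)
    fix a b assume ab: "a \<in> carrier G.L" "b \<in> carrier G.L" "\<phi> a = \<phi> b"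
    obtain i x where a: "a = G.incl i x" "i \<in> I" "x \<in> carrier (G i)" using ab G.carrier_limit by auto
    obtain p y where b: "b = G.incl p y" "p \<in> I" "y \<in> carrier (G p)" using ab G.carrier_limit by auto
    have "H.incl (c i) (u i (c i) x) = H.incl (c p) (u p (c p) y)"
      using ab a b \<phi>_c by simp
    then obtain l where l: "l \<in> J" "c i \<le> l" "c p \<le> l"
        and eq: "g (c i) l (u i (c i) x) = g (c p) l (u p (c p) y)"
      using H.incl_eqD[of "c i" "c p" "u i (c i) x" "u p (c p) y"] a b c u_closed by auto
    have "u i l x = u p l y" using eq g_u[of i "c i" l x] g_u[of p "c p" l y] a b c l by simp
    moreover have P: "P i l" "P p l" using P_up[of i "c i" l] P_up[of p "c p" l] c a b l by blast+
    \<comment> \<open>Equality at the index \<open>l\<close> of the second system returns to the first one at an index above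
      \<open>i\<close> and \<open>p\<close> whose ring receives the one at \<open>l\<close>.\<close>
    moreover obtain q where q: "q \<in> I" "Q l q" using Q_ex l by blast
    moreover obtain r where r: "r \<in> I" "i \<le> r" "p \<le> r" using G.upper_bound a b by blast
    moreover obtain m where m: "m \<in> I" "q \<le> m" "r \<le> m" using G.upper_bound q r by blast
    ultimately have "f i m x = f p m y"
      using v_u[of i l m x] v_u[of p l m y] Q_up[of l q m] a b l by simp
    moreover have "i \<le> m" "p \<le> m" using r m by auto
    ultimately show "a = b" using a b m G.incl_eqI[of i p m x y] by simp
  qed
  moreover have "\<phi> ` carrier G.L = carrier H.L"
  proof
    show "\<phi> ` carrier G.L \<subseteq> carrier H.L" using ring_hom_closed[OF \<phi>_hom] by blast
    show "carrier H.L \<subseteq> \<phi> ` carrier G.L"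
    proof
      fix b assume "b \<in> carrier H.L"
      then obtain j y where b: "b = H.incl j y" "j \<in> J" "y \<in> carrier (H j)"
        using H.carrier_limit by auto
      obtain i where i: "i \<in> I" "Q j i" using Q_ex b by blast
      have "\<phi> (G.incl i (v j i y)) = b" using \<phi>_v b i by simp
      moreover have "G.incl i (v j i y) \<in> carrier G.L"
        using G.carrier_limit i v_closed b by blast
      ultimately show "b \<in> \<phi> ` carrier G.L" by blast
    qed
  qed
  ultimately have "\<phi> \<in> ring_iso G.L H.L"
    using \<phi>_hom by (simp add: ring_iso_def bij_betw_def)
  then show ?thesis
    by (rule bexI[rotated]) (intro conjI ballI impI; (rule \<phi>_u \<phi>_v; assumption))
qed


section \<open>The maximal ideal of a local ring\<close>

lemma (in ring) ideal_Union_chain: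
  assumes "C \<noteq> {}" "subset.chain {J. ideal J R} C"
  shows "ideal (\<Union>C) R"
proof (rule idealI)
  have C: "ideal J R" if "J \<in> C" for J
    using that assms(2) unfolding pred_on.chain_def by auto
  note id = C[THEN ideal.axioms(1)]
  show "ring R" by (rule ring_axioms)
  show "subgroup (\<Union>C) (add_monoid R)"
  proof (rule add.subgroupI)
    show "\<Union>C \<subseteq> carrier R" using id[THEN additive_subgroup.a_subset] by blast
    show "\<Union>C \<noteq> {}" using assms(1) id[THEN additive_subgroup.zero_closed] by blast
    show "\<ominus> a \<in> \<Union>C" if "a \<in> \<Union>C" for a
      using that id[THEN additive_subgroup.a_inv_closed] by blast
    show "a \<oplus> b \<in> \<Union>C" if ab: "a \<in> \<Union>C" "b \<in> \<Union>C" for a b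
    proof -
      obtain A B where AB: "A \<in> C" "B \<in> C" "a \<in> A" "b \<in> B" using ab by blast
      then have "A \<subseteq> B \<or> B \<subseteq> A" using assms(2) unfolding pred_on.chain_def by auto
      then show ?thesis using AB id[THEN additive_subgroup.a_closed] by blast
    qed
  qed
  show "x \<otimes> a \<in> \<Union>C" "a \<otimes> x \<in> \<Union>C" if "a \<in> \<Union>C" "x \<in> carrier R" for a x
    using that C[THEN ideal.I_l_closed] C[THEN ideal.I_r_closed] by blast+
qed

text \<open>By Zorn's lemma there is a maximal element among the ideals that contain \<open>x\<close> but not \<open>\<one>\<close>; the
  principal ideal of \<open>x\<close> is one of them because \<open>x\<close> is not a unit.\<close>

lemma (in cring) nonunit_in_maximalideal:
  assumes x: "x \<in> carrier R" "x \<notin> Units R"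
  obtains M where "maximalideal M R" "x \<in> M"
proof -
  let ?\<A> = "{J. ideal J R \<and> \<one> \<notin> J \<and> x \<in> J}"
  have "\<one> \<notin> PIdl x"
    using x m_comm unfolding cgenideal_def Units_def by auto
  then have "PIdl x \<in> ?\<A>" using x cgenideal_ideal cgenideal_self by auto
  then have "?\<A> \<noteq> {}" by blast
  moreover have "\<Union>C \<in> ?\<A>" if "C \<noteq> {}" "subset.chain ?\<A> C" for C
  proof -
    have "subset.chain {J. ideal J R} C"
      using that(2) unfolding pred_on.chain_def by auto
    then show ?thesis
      using ideal_Union_chain that unfolding pred_on.chain_def by auto
  qed
  ultimately obtain M where M: "M \<in> ?\<A>" and max: "\<And>N. N \<in> ?\<A> \<Longrightarrow> M \<subseteq> N \<Longrightarrow> N = M"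
    using subset_Zorn_nonempty[of ?\<A>] by blast
  have "maximalideal M R"
  proof (rule maximalidealI)
    show "ideal M R" using M by blast
    show "carrier R \<noteq> M" using M by auto
    show "J = M \<or> J = carrier R" if "ideal J R" "M \<subseteq> J" "J \<subseteq> carrier R" for J
      using that M max[of J] ideal.one_imp_carrier[of J R] by blast
  qed
  then show thesis using that M by blast
qed

lemma maximalideal_max_ideal: "local_ring R \<Longrightarrow> maximalideal (max_ideal R) R"
  unfolding local_ring_def max_ideal_def by (elim conjE) (rule theI')

lemma max_ideal_eq_nonunits:
  fixes R (structure)
  assumes "local_ring R"
  shows "max_ideal R = carrier R - Units R"
proof -
  interpret cring R using assms by (simp add: local_ring_def)
  interpret maximalideal "max_ideal R" R by (rule maximalideal_max_ideal[OF assms])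
  have "x \<in> max_ideal R" if x: "x \<in> carrier R - Units R" for x
  proof -
    obtain M where M: "maximalideal M R" "x \<in> M" using nonunit_in_maximalideal[of x] x by blast
    have "max_ideal R = M"
      using assms M(1) unfolding local_ring_def max_ideal_def by (intro the1_equality) simp_all
    then show ?thesis using M(2) by simp
  qed
  moreover have "x \<notin> max_ideal R" if "x \<in> Units R" for x
    using that I_r_closed[of x "inv x"] one_imp_carrier I_notcarr by auto
  moreover have "max_ideal R \<subseteq> carrier R" by (rule a_subset)
  ultimately show ?thesis by blast
qed

lemma Units_mono:
  assumes "A \<subseteq> B"
  shows "Units (K\<lparr>carrier := A\<rparr>) \<subseteq> Units (K\<lparr>carrier := B\<rparr>)"
  using assms unfolding Units_def by auto

text \<open>Maximal ideals consist of the non-units, and units of \<open>A\<close> are always units of \<open>B\<close>. In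
  this form domination by \<open>B\<close> follows from the same condition on the units of any ring that contains
  \<open>B\<close>, in particular of the union of a system.\<close>

lemma dominates_iff_units:
  assumes "local_ring (K\<lparr>carrier := A\<rparr>)" "local_ring (K\<lparr>carrier := B\<rparr>)"
  shows "dominates K B A \<longleftrightarrow> A \<subseteq> B \<and> Units (K\<lparr>carrier := B\<rparr>) \<inter> A \<subseteq> Units (K\<lparr>carrier := A\<rparr>)"
  using Units_mono[of A B K]
  unfolding dominates_def assms[THEN max_ideal_eq_nonunits] by (auto simp: Units_def)

lemma dominates_subset: "dominates K B A \<Longrightarrow> A \<subseteq> B"
  by (simp add: dominates_def)

lemma dominates_refl: "local_ring (K\<lparr>carrier := A\<rparr>) \<Longrightarrow> dominates K A A"
  by (simp add: dominates_iff_units)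

lemma dominates_trans: "\<lbrakk>dominates K B A; dominates K C B\<rbrakk> \<Longrightarrow> dominates K C A"
  unfolding dominates_def by blast


section \<open>Completion along dominated local rings\<close>

text \<open>Elements of the completion are handled through representatives of their cosets. This makes
  the induced maps transparent: they leave the sequence of representatives unchanged.\<close>

definition coherent :: "('a, 'b) ring_scheme \<Rightarrow> (nat \<Rightarrow> 'a) \<Rightarrow> bool"
  where "coherent R a \<longleftrightarrow> (\<forall>n. a n \<in> carrier R \<and>
    max_power R n +>\<^bsub>R\<^esub> a (Suc n) = max_power R n +>\<^bsub>R\<^esub> a n)"

definition coset_sequence :: "('a, 'b) ring_scheme \<Rightarrow> (nat \<Rightarrow> 'a) \<Rightarrow> (nat \<Rightarrow> 'a set)"
  where "coset_sequence R a = (\<lambda>n. max_power R n +>\<^bsub>R\<^esub> a n)"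

lemma (in ring) ideal_ideal_power: "ideal m R \<Longrightarrow> ideal (ideal_power R m n) R"
  by (induction n) (auto simp: oneideal ideal_prod_is_ideal)

lemma ideal_max_power:
  assumes "local_ring R"
  shows "ideal (max_power R n) R"
proof -
  interpret cring R using assms by (simp add: local_ring_def)
  show ?thesis
    using maximalideal_max_ideal[OF assms] by (intro ideal_ideal_power) (simp add: maximalideal_def)
qed

text \<open>Used with \<open>M = m\<^sup>n\<^sup>+\<^sup>1\<close>, \<open>N = m\<^sup>n\<close> for the projections of the inverse limit, and with powers
  of the maximal ideals of two rings, one dominating the other, for the maps of completions. In the
  second case \<open>M\<close> is not an ideal of the ring, whence the weak hypotheses on \<open>M\<close>.\<close>

lemma (in ring) coset_add_ideal:
  assumes N: "ideal N R" and M: "M \<subseteq> N" "\<zero> \<in> M" and a: "a \<in> carrier R"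
  shows "(M +> a) <+>\<^bsub>R\<^esub> N = N +> a"
proof -
  interpret ideal N R by (rule N)
  have carr: "x \<in> carrier R" if "x \<in> N" for x using that a_subset by blast
  show ?thesis
  proof (intro equalityI subsetI)
    fix z assume "z \<in> (M +> a) <+>\<^bsub>R\<^esub> N"
    then obtain x y where z: "z = (x \<oplus> a) \<oplus> y" "x \<in> N" "y \<in> N"
      using M(1) unfolding a_r_coset_def' set_add_def' by auto
    then have "z = (x \<oplus> y) \<oplus> a" using carr[OF z(2)] carr[OF z(3)] a by algebra
    moreover have "x \<oplus> y \<in> N" using z by blast
    ultimately show "z \<in> N +> a" unfolding a_r_coset_def' by auto
  next
    fix z assume "z \<in> N +> a"
    then obtain y where z: "z = y \<oplus> a" "y \<in> N" unfolding a_r_coset_def' by auto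
    then have "z = (\<zero> \<oplus> a) \<oplus> y" using carr[OF z(2)] a by algebra
    then show "z \<in> (M +> a) <+>\<^bsub>R\<^esub> N" using M(2) z(2) unfolding a_r_coset_def' set_add_def' by auto
  qed
qed

lemma ideal_power_mono:
  assumes "A \<subseteq> B" "m \<subseteq> m'"
  shows "ideal_power (K\<lparr>carrier := A\<rparr>) m n \<subseteq> ideal_power (K\<lparr>carrier := B\<rparr>) m' n"
proof (induction n)
  case (Suc n)
  have "x \<in> ideal_power (K\<lparr>carrier := B\<rparr>) m' n \<cdot>\<^bsub>K\<lparr>carrier := B\<rparr>\<^esub> m'"
    if "x \<in> ideal_power (K\<lparr>carrier := A\<rparr>) m n \<cdot>\<^bsub>K\<lparr>carrier := A\<rparr>\<^esub> m" for x
    using that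
  proof induction
    case (prod i j)
    then show ?case
      using Suc assms ideal_prod.prod[of i _ j m' "K\<lparr>carrier := B\<rparr>"] by auto
  next
    case (sum s t)
    then show ?case
      using ideal_prod.sum[of s "K\<lparr>carrier := B\<rparr>" _ m' t] by auto
  qed
  then show ?case by auto
qed (use assms in simp)

lemma coset_add_max_power:
  assumes A: "local_ring (K\<lparr>carrier := A\<rparr>)" and B: "local_ring (K\<lparr>carrier := B\<rparr>)"
    and dom: "dominates K B A" and a: "a \<in> A"
  shows "(max_power (K\<lparr>carrier := A\<rparr>) n +>\<^bsub>K\<lparr>carrier := A\<rparr>\<^esub> a) <+>\<^bsub>K\<lparr>carrier := B\<rparr>\<^esub> max_power (K\<lparr>carrier := B\<rparr>) n
    = max_power (K\<lparr>carrier := B\<rparr>) n +>\<^bsub>K\<lparr>carrier := B\<rparr>\<^esub> a"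
proof -
  interpret B: cring "K\<lparr>carrier := B\<rparr>" using B by (simp add: local_ring_def)
  have "max_power (K\<lparr>carrier := A\<rparr>) n \<subseteq> max_power (K\<lparr>carrier := B\<rparr>) n"
    using dom unfolding dominates_def by (intro ideal_power_mono) auto
  moreover have "\<zero>\<^bsub>K\<^esub> \<in> max_power (K\<lparr>carrier := A\<rparr>) n" 
    using additive_subgroup.zero_closed[OF ideal.axioms(1)[OF ideal_max_power[OF A]]] by simp
  moreover have "a \<in> B" using dom a by (auto simp: dominates_def)
  moreover have "max_power (K\<lparr>carrier := A\<rparr>) n +>\<^bsub>K\<lparr>carrier := A\<rparr>\<^esub> a
      = max_power (K\<lparr>carrier := A\<rparr>) n +>\<^bsub>K\<lparr>carrier := B\<rparr>\<^esub> a"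
    by (simp add: a_r_coset_def')
  ultimately show ?thesis
    using B.coset_add_ideal[OF ideal_max_power[OF B]] by simp
qed

lemma carrier_completion:
  assumes "local_ring R"
  shows "carrier (completion R) = coset_sequence R ` {a. coherent R a}"
proof -
  interpret cring R using assms by (simp add: local_ring_def)
  have "max_power R (Suc n) \<subseteq> max_power R n" for n
    using ideal_prod_inter[OF ideal_max_power[OF assms], of "max_ideal R" n]
      maximalideal_max_ideal[OF assms] by (auto simp: maximalideal_def)
  then have step: "(max_power R (Suc n) +>\<^bsub>R\<^esub> a) <+>\<^bsub>R\<^esub> max_power R n = max_power R n +>\<^bsub>R\<^esub> a"
    if "a \<in> carrier R" for a n
    using coset_add_ideal[OF ideal_max_power[OF assms], of "max_power R (Suc n)" n a] that
      ideal_max_power[OF assms, of "Suc n", THEN ideal.axioms(1), THEN additive_subgroup.zero_closed]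
    by blast
  have quot: "carrier (R Quot max_power R n) = {max_power R n +>\<^bsub>R\<^esub> a | a. a \<in> carrier R}" for n
    unfolding FactRing_simps by auto
  show ?thesis
  proof (intro equalityI subsetI)
    fix x assume x: "x \<in> carrier (completion R)"
    have "\<exists>a. a \<in> carrier R \<and> x n = max_power R n +>\<^bsub>R\<^esub> a" for n
      using x unfolding completion_def by (simp add: quot) blast
    then obtain a where a: "\<And>n. a n \<in> carrier R \<and> x n = max_power R n +>\<^bsub>R\<^esub> a n" by metis
    have "x (Suc n) <+>\<^bsub>R\<^esub> max_power R n = x n" for n
      using x by (simp add: completion_def)
    then have "max_power R n +>\<^bsub>R\<^esub> a (Suc n) = max_power R n +>\<^bsub>R\<^esub> a n" for n
      using a step[of "a (Suc n)" n] by metis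
    then have "coherent R a" using a unfolding coherent_def by blast
    moreover have "x = coset_sequence R a" using a by (auto simp: coset_sequence_def)
    ultimately show "x \<in> coset_sequence R ` {a. coherent R a}" by blast
  next
    fix x assume "x \<in> coset_sequence R ` {a. coherent R a}"
    then show "x \<in> carrier (completion R)"
      using step unfolding coset_sequence_def coherent_def
      by (auto simp: completion_def quot simp del: ideal_power.simps)
  qed
qed

lemma
  assumes "local_ring R" "coherent R a" "coherent R b"
  shows coset_sequence_mult: "coset_sequence R a \<otimes>\<^bsub>completion R\<^esub> coset_sequence R b
      = coset_sequence R (\<lambda>n. a n \<otimes>\<^bsub>R\<^esub> b n)"
    and coset_sequence_add: "coset_sequence R a \<oplus>\<^bsub>completion R\<^esub> coset_sequence R b
      = coset_sequence R (\<lambda>n. a n \<oplus>\<^bsub>R\<^esub> b n)"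
proof -
  have "a n \<in> carrier R" "b n \<in> carrier R" for n
    using assms(2,3) by (simp_all add: coherent_def)
  note coset = ideal.rcoset_mult_add[OF ideal_max_power[OF assms(1)] this]
    ideal.a_rcos_sum[OF ideal_max_power[OF assms(1)] this]
  show "coset_sequence R a \<otimes>\<^bsub>completion R\<^esub> coset_sequence R b = coset_sequence R (\<lambda>n. a n \<otimes>\<^bsub>R\<^esub> b n)"
    "coset_sequence R a \<oplus>\<^bsub>completion R\<^esub> coset_sequence R b = coset_sequence R (\<lambda>n. a n \<oplus>\<^bsub>R\<^esub> b n)"
    by (simp_all add: coset_sequence_def completion_def FactRing_def coset)
qed

lemma coset_sequence_one: "\<one>\<^bsub>completion R\<^esub> = coset_sequence R (\<lambda>n. \<one>\<^bsub>R\<^esub>)"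
  by (simp add: coset_sequence_def completion_def FactRing_def)

lemma
  assumes "local_ring R" "coherent R a" "coherent R b"
  shows coherent_mult: "coherent R (\<lambda>n. a n \<otimes>\<^bsub>R\<^esub> b n)"
    and coherent_add: "coherent R (\<lambda>n. a n \<oplus>\<^bsub>R\<^esub> b n)"
proof -
  interpret cring R using assms by (simp add: local_ring_def)
  show "coherent R (\<lambda>n. a n \<otimes>\<^bsub>R\<^esub> b n)"
    using assms unfolding coherent_def
    by (auto simp flip: ideal.rcoset_mult_add[OF ideal_max_power[OF assms(1)]])
  show "coherent R (\<lambda>n. a n \<oplus>\<^bsub>R\<^esub> b n)"
    using assms unfolding coherent_def
    by (auto simp flip: ideal.a_rcos_sum[OF ideal_max_power[OF assms(1)]])
qed

lemma coherent_one: "local_ring R \<Longrightarrow> coherent R (\<lambda>n. \<one>\<^bsub>R\<^esub>)"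
  unfolding coherent_def local_ring_def by (simp add: cring.cring_simprules)

lemma completion_closed:
  assumes "local_ring R"
  shows "\<lbrakk>x \<in> carrier (completion R); y \<in> carrier (completion R)\<rbrakk>
      \<Longrightarrow> x \<otimes>\<^bsub>completion R\<^esub> y \<in> carrier (completion R)"
    and "\<lbrakk>x \<in> carrier (completion R); y \<in> carrier (completion R)\<rbrakk>
      \<Longrightarrow> x \<oplus>\<^bsub>completion R\<^esub> y \<in> carrier (completion R)"
    and "\<one>\<^bsub>completion R\<^esub> \<in> carrier (completion R)"
  using assms coherent_mult[OF assms] coherent_add[OF assms] coherent_one[OF assms]
  by (auto simp: carrier_completion coset_sequence_mult coset_sequence_add coset_sequence_one)

lemma
  assumes "local_ring (K\<lparr>carrier := A\<rparr>)" "local_ring (K\<lparr>carrier := B\<rparr>)" "dominates K B A"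
    "coherent (K\<lparr>carrier := A\<rparr>) a"
  shows completion_map_coset_sequence:
      "completion_of_map K B (coset_sequence (K\<lparr>carrier := A\<rparr>) a) = coset_sequence (K\<lparr>carrier := B\<rparr>) a"
    and coherent_dominating: "coherent (K\<lparr>carrier := B\<rparr>) a"
proof -
  have a: "a n \<in> A" for n using assms(4) by (simp add: coherent_def)
  note coset = coset_add_max_power[OF assms(1-3) a]
  show "completion_of_map K B (coset_sequence (K\<lparr>carrier := A\<rparr>) a) = coset_sequence (K\<lparr>carrier := B\<rparr>) a"
    by (simp add: completion_map_def coset_sequence_def coset)
  have "a n \<in> B" for n using a assms(3) by (auto simp: dominates_def)
  then show "coherent (K\<lparr>carrier := B\<rparr>) a"
    using assms(4) unfolding coherent_def by (simp flip: coset)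
qed

lemma completion_map_hom:
  assumes "local_ring (K\<lparr>carrier := A\<rparr>)" "local_ring (K\<lparr>carrier := B\<rparr>)" "dominates K B A"
  shows "completion_of_map K B \<in> ring_hom (completion_of K A) (completion_of K B)"
proof (rule ring_hom_memI)
  note map = completion_map_coset_sequence[OF assms] and coh = coherent_dominating[OF assms]
    and carr = carrier_completion[OF assms(1)] carrier_completion[OF assms(2)]
  fix x assume "x \<in> carrier (completion_of K A)"
  then obtain a where a: "x = coset_sequence (K\<lparr>carrier := A\<rparr>) a" "coherent (K\<lparr>carrier := A\<rparr>) a"
    using carr by auto
  then show "completion_of_map K B x \<in> carrier (completion_of K B)"
    using carr map coh by simp
  fix y assume "y \<in> carrier (completion_of K A)"
  then obtain b where b: "y = coset_sequence (K\<lparr>carrier := A\<rparr>) b" "coherent (K\<lparr>carrier := A\<rparr>) b"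
    using carr by auto
  show "completion_of_map K B (x \<otimes>\<^bsub>completion_of K A\<^esub> y)
      = completion_of_map K B x \<otimes>\<^bsub>completion_of K B\<^esub> completion_of_map K B y"
    using a b assms map coh coherent_mult[OF assms(1) a(2) b(2)] by (simp add: coset_sequence_mult)
  show "completion_of_map K B (x \<oplus>\<^bsub>completion_of K A\<^esub> y)
      = completion_of_map K B x \<oplus>\<^bsub>completion_of K B\<^esub> completion_of_map K B y"
    using a b assms map coh coherent_add[OF assms(1) a(2) b(2)] by (simp add: coset_sequence_add)
next
  show "completion_of_map K B \<one>\<^bsub>completion_of K A\<^esub> = \<one>\<^bsub>completion_of K B\<^esub>"
    using completion_map_coset_sequence[OF assms coherent_one[OF assms(1)]]
    by (simp add: coset_sequence_one)
qed

lemma completion_map_id: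
  assumes "local_ring (K\<lparr>carrier := A\<rparr>)" "x \<in> carrier (completion_of K A)"
  shows "completion_of_map K A x = x"
  using assms(2) completion_map_coset_sequence[OF assms(1,1) dominates_refl[OF assms(1)]]
  by (auto simp: carrier_completion[OF assms(1)])

lemma completion_map_trans:
  assumes "local_ring (K\<lparr>carrier := A\<rparr>)" "local_ring (K\<lparr>carrier := B\<rparr>)" "local_ring (K\<lparr>carrier := C\<rparr>)"
    and "dominates K B A" "dominates K C B" "x \<in> carrier (completion_of K A)"
  shows "completion_of_map K C (completion_of_map K B x) = completion_of_map K C x"
proof -
  obtain a where a: "x = coset_sequence (K\<lparr>carrier := A\<rparr>) a" "coherent (K\<lparr>carrier := A\<rparr>) a"
    using assms(6) carrier_completion[OF assms(1)] by auto
  show ?thesis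
    using completion_map_coset_sequence[OF assms(1,2,4) a(2)] coherent_dominating[OF assms(1,2,4) a(2)]
      completion_map_coset_sequence[OF assms(2,3,5), of a]
      completion_map_coset_sequence[OF assms(1,3) dominates_trans[OF assms(4,5)] a(2)] a(1)
    by simp
qed


section \<open>Systems of local rings with a common union\<close>

lemma system_local:
  "\<lbrakk>normal_local_system K k V I R; i \<in> I\<rbrakk> \<Longrightarrow> local_ring (K\<lparr>carrier := R i\<rparr>)"
  by (simp add: normal_local_system_def)

lemma system_directed:
  "\<lbrakk>normal_local_system K k V I R; i \<in> I; j \<in> I\<rbrakk> \<Longrightarrow> \<exists>l \<in> I. i \<le> l \<and> j \<le> l"
  by (simp add: normal_local_system_def)

lemma system_dominates:
  "\<lbrakk>normal_local_system K k V I R; i \<in> I; j \<in> I; i \<le> j\<rbrakk> \<Longrightarrow> dominates K (R j) (R i)"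
  using dominates_refl system_local unfolding normal_local_system_def order_le_less by blast

text \<open>The inverse of \<open>x\<close> lies in some \<open>R l\<close> with \<open>i \<le> l\<close>, and \<open>R l\<close> dominates \<open>R i\<close>.\<close>

lemma system_Units:
  assumes sys: "normal_local_system K k V I R" and i: "i \<in> I"
  shows "Units (K\<lparr>carrier := V\<rparr>) \<inter> R i \<subseteq> Units (K\<lparr>carrier := R i\<rparr>)"
proof
  fix x assume x: "x \<in> Units (K\<lparr>carrier := V\<rparr>) \<inter> R i"
  then obtain y where y: "y \<in> V" "y \<otimes>\<^bsub>K\<^esub> x = \<one>\<^bsub>K\<^esub>" "x \<otimes>\<^bsub>K\<^esub> y = \<one>\<^bsub>K\<^esub>"
    unfolding Units_def by auto
  then obtain j where j: "j \<in> I" "y \<in> R j" using sys unfolding normal_local_system_def by auto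
  obtain l where l: "l \<in> I" "i \<le> l" "j \<le> l" using system_directed[OF sys i j(1)] by blast
  note dom = system_dominates[OF sys i l(1,2)] system_dominates[OF sys j(1) l(1,3)]
  have "x \<in> R l" "y \<in> R l" using dom x j unfolding dominates_def by auto
  then have "x \<in> Units (K\<lparr>carrier := R l\<rparr>)" using y unfolding Units_def by auto
  then show "x \<in> Units (K\<lparr>carrier := R i\<rparr>)"
    using dom(1) x dominates_iff_units[OF system_local[OF sys i] system_local[OF sys l(1)]] by blast
qed

text \<open>The rings \<open>R i\<close> and \<open>S j\<close> come from different systems, but a unit of \<open>S j\<close> is a unit of the common
  union \<open>V\<close>, and thus of \<open>R i\<close> if it lies there.\<close>

lemma systems_dominates:
  assumes R: "normal_local_system K k V I R" and S: "normal_local_system K k V J S"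
    and i: "i \<in> I" and j: "j \<in> J" and sub: "R i \<subseteq> S j"
  shows "dominates K (S j) (R i)"
proof -
  have "S j \<subseteq> V" using S j unfolding normal_local_system_def by auto
  then have "Units (K\<lparr>carrier := S j\<rparr>) \<inter> R i \<subseteq> Units (K\<lparr>carrier := R i\<rparr>)"
    using Units_mono[of "S j" V K] system_Units[OF R i] by blast
  then show ?thesis
    using dominates_iff_units[OF system_local[OF R i] system_local[OF S j]] sub by blast
qed

lemma system_absorbs_finite:
  assumes sys: "normal_local_system K k V I R" and "finite F" "F \<subseteq> V"
  shows "\<exists>i \<in> I. F \<subseteq> R i"
  using assms(2,3)
proof (induction F)
  case empty
  then show ?case using sys unfolding normal_local_system_def by blast
next
  case (insert x F)
  obtain i where i: "i \<in> I" "F \<subseteq> R i" using insert by auto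
  obtain j where j: "j \<in> I" "x \<in> R j" using insert sys unfolding normal_local_system_def by auto
  obtain l where l: "l \<in> I" "i \<le> l" "j \<le> l" using system_directed[OF sys i(1) j(1)] by blast
  have "R i \<subseteq> R l" "R j \<subseteq> R l"
    using system_dominates[OF sys i(1) l(1,2)] system_dominates[OF sys j(1) l(1,3)]
    by (simp_all add: dominates_subset)
  then have "insert x F \<subseteq> R l" using i(2) j(2) by blast
  then show ?case using l(1) by (rule bexI)
qed

text \<open>If \<open>A\<close> is the localization of \<open>C = k[F]\<close> at \<open>W\<close>, then a ring that contains \<open>k\<close> and \<open>F\<close> contains
  \<open>C\<close> and \<open>W\<close>, and it contains \<open>A\<close> once it contains the inverses of the elements of \<open>W\<close>. These
  elements are units of \<open>A\<close>, which is the only thing about \<open>W\<close> that the conclusion remembers.\<close>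

lemma (in field) ess_finite_type_generators:
  assumes "subfield k R" "ess_finite_type R k A"
  obtains F where "finite F" "k \<union> F \<subseteq> A"
    "\<And>B. \<lbrakk>subring B R; k \<union> F \<subseteq> B; \<And>w. \<lbrakk>w \<in> A \<inter> B; w \<in> Units R; inv w \<in> A\<rbrakk> \<Longrightarrow> inv w \<in> B\<rbrakk> \<Longrightarrow> A \<subseteq> B"
proof -
  obtain F W where F: "finite F" "F \<subseteq> carrier R" and W: "submonoid W R"
    and WC: "W \<subseteq> generate_ring R (k \<union> F) - {\<zero>}"
    and A: "A = {b \<otimes> inv w | b w. b \<in> generate_ring R (k \<union> F) \<and> w \<in> W}"
    using assms(2) unfolding ess_finite_type_def by blast
  define C where "C = generate_ring R (k \<union> F)"
  note A = A[folded C_def] and WC = WC[folded C_def]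
  have kF: "k \<union> F \<subseteq> carrier R" using F subfieldE(3)[OF assms(1)] by blast
  have C: "subring C R" "k \<union> F \<subseteq> C"
    using generate_ring_is_subring[OF kF] generate_ring.incl[of _ "k \<union> F" R] by (auto simp: C_def)
  have unit: "w \<in> Units R" if "w \<in> W" for w
    using that WC subringE(1)[OF C(1)] field_Units by auto
  have CA: "C \<subseteq> A"
  proof
    fix b assume b: "b \<in> C"
    then have "b = b \<otimes> inv \<one>" using subringE(1)[OF C(1)] by auto
    then show "b \<in> A" unfolding A using b submonoid.one_closed[OF W] by blast
  qed
  have inv_A: "inv w \<in> A" if w: "w \<in> W" for w
  proof -
    have "inv w = \<one> \<otimes> inv w" using unit[OF w] by simp
    then show ?thesis unfolding A using w subringE(3)[OF C(1)] by blast
  qed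
  show thesis
  proof (rule that)
    show "finite F" by (rule F)
    show "k \<union> F \<subseteq> A" using C(2) CA by blast
    fix B assume B: "subring B R" "k \<union> F \<subseteq> B"
      and inv_B: "\<And>w. \<lbrakk>w \<in> A \<inter> B; w \<in> Units R; inv w \<in> A\<rbrakk> \<Longrightarrow> inv w \<in> B"
    have CB: "C \<subseteq> B" unfolding C_def using generate_ring_min_subring1[OF kF B] .
    show "A \<subseteq> B"
    proof
      fix x assume "x \<in> A"
      then obtain b w where x: "x = b \<otimes> inv w" "b \<in> C" "w \<in> W" unfolding A by blast
      have "inv w \<in> B" using inv_B[of w] x(3) WC CA CB unit inv_A by blast
      then show "x \<in> B" using x CB subringE(6)[OF B(1)] by blast
    qed
  qed
qed

text \<open>A ring \<open>Q j\<close> that contains the generators of \<open>P i\<close> contains the inverses demanded by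
  \<open>ess_finite_type_generators\<close>: an element of \<open>Q j\<close> that is a unit of \<open>P i\<close> is a unit of \<open>V\<close>, hence of
  \<open>Q j\<close>.\<close>

lemma (in field) systems_cofinal:
  assumes k: "subfield k R" and P: "normal_local_system R k V I P" and Q: "normal_local_system R k V J Q"
    and i: "i \<in> I"
  shows "\<exists>j \<in> J. dominates R (Q j) (P i)"
proof -
  have PV: "P i \<subseteq> V" and eft: "ess_finite_type R k (P i)"
    using P i unfolding normal_local_system_def by auto
  obtain F where F: "finite F" "k \<union> F \<subseteq> P i"
    and absorb: "\<And>B. \<lbrakk>subring B R; k \<union> F \<subseteq> B;
      \<And>w. \<lbrakk>w \<in> P i \<inter> B; w \<in> Units R; inv w \<in> P i\<rbrakk> \<Longrightarrow> inv w \<in> B\<rbrakk> \<Longrightarrow> P i \<subseteq> B"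
    using ess_finite_type_generators[OF k eft] by metis
  obtain j where j: "j \<in> J" "F \<subseteq> Q j"
    using system_absorbs_finite[OF Q F(1)] F(2) PV by blast
  have Qj: "subring (Q j) R" and eftY: "ess_finite_type R k (Q j)"
    using Q j unfolding normal_local_system_def normal_subring_def by auto
  have "k \<subseteq> Q j" using ess_finite_type_generators[OF k eftY] by (metis Un_subset_iff)
  have "P i \<subseteq> Q j"
  proof (rule absorb)
    fix w assume w: "w \<in> P i \<inter> Q j" "w \<in> Units R" "inv w \<in> P i"
    then have "w \<in> Units (R\<lparr>carrier := V\<rparr>)"
      using PV Units_l_inv[of w] Units_r_inv[of w] unfolding Units_def[of "R\<lparr>carrier := V\<rparr>"]
      by (auto intro!: bexI[of _ "inv w"])
    then have "w \<in> Units (R\<lparr>carrier := Q j\<rparr>)" using system_Units[OF Q j(1)] w by blast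
    then obtain z where z: "z \<in> Q j" "w \<otimes> z = \<one>" unfolding Units_def by auto
    then have "inv w = z" using w subringE(1)[OF Qj] by (intro comm_inv_char) auto
    then show "inv w \<in> Q j" using z by simp
  qed (use Qj \<open>k \<subseteq> Q j\<close> j in auto)
  then show ?thesis using systems_dominates[OF P Q i j(1)] j(1) by blast
qed

lemma direct_system_completions:
  assumes "normal_local_system K k V I R"
  shows "direct_system I (\<lambda>i. completion_of K (R i)) (\<lambda>i j. completion_of_map K (R j))"
  using system_local[OF assms] system_dominates[OF assms] assms
  by unfold_locales
    (auto simp: completion_closed completion_map_hom completion_map_id normal_local_system_def
      intro!: completion_map_trans)

theorem lemma4p1:
  fixes K :: "('a, 'b) ring_scheme" and k V :: "'a set"
    and I :: "'i::order set" and R :: "'i \<Rightarrow> 'a set"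
    and J :: "'j::order set" and S :: "'j \<Rightarrow> 'a set"
  assumes "function_field K k"
    and "valuation_ring K V"
    and "normal_local_system K k V I R"
    and "normal_local_system K k V J S"
  shows "(\<forall>i \<in> I. \<exists>j \<in> J. dominates K (S j) (R i)) \<and>
    (\<forall>j \<in> J. \<exists>i \<in> I. dominates K (R i) (S j)) \<and>
    (\<exists>\<phi> \<in> ring_iso (completion_union K I R) (completion_union K J S).
       (\<forall>i \<in> I. \<forall>j \<in> J. R i \<subseteq> S j \<longrightarrow>
          (\<forall>x \<in> carrier (completion_of K (R i)).
             \<phi> (completion_incl K I R i x)
               = completion_incl K J S j (completion_of_map K (S j) x))) \<and>
       (\<forall>i \<in> I. \<forall>j \<in> J. S j \<subseteq> R i \<longrightarrow>
          (\<forall>y \<in> carrier (completion_of K (S j)).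
             \<phi> (completion_incl K I R i (completion_of_map K (R i) y))
               = completion_incl K J S j y)))"
proof -
  interpret field K using assms(1) by (simp add: function_field_def)
  have k: "subfield k K" using assms(1) by (simp add: function_field_def)
  note R = assms(3) and S = assms(4)
  note cofinal = systems_cofinal[OF k R S] systems_cofinal[OF k S R]
  note locR = system_local[OF R] and locS = system_local[OF S]
    and domR = system_dominates[OF R] and domS = system_dominates[OF S]
    and domRS = systems_dominates[OF R S] and domSR = systems_dominates[OF S R]
  have "\<exists>\<phi> \<in> ring_iso (completion_union K I R) (completion_union K J S).
       (\<forall>i \<in> I. \<forall>j \<in> J. R i \<subseteq> S j \<longrightarrow>
          (\<forall>x \<in> carrier (completion_of K (R i)).
             \<phi> (completion_incl K I R i x)
               = completion_incl K J S j (completion_of_map K (S j) x))) \<and>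
       (\<forall>i \<in> I. \<forall>j \<in> J. S j \<subseteq> R i \<longrightarrow>
          (\<forall>y \<in> carrier (completion_of K (S j)).
             \<phi> (completion_incl K I R i (completion_of_map K (R i) y))
               = completion_incl K J S j y))"
    unfolding completion_union_def completion_incl_def
  proof (rule interleaved_limits_isomorphic[OF direct_system_completions[OF R]
        direct_system_completions[OF S]])
    fix i j l assume ij: "i \<in> I" "j \<in> J" "l \<in> J" "R i \<subseteq> S j" "j \<le> l"
    then show "R i \<subseteq> S l" using dominates_subset[OF domS] by blast
    fix x assume "x \<in> carrier (completion_of K (R i))"
    with ij show "completion_of_map K (S l) (completion_of_map K (S j) x) = completion_of_map K (S l) x"
      using locR locS domRS domS by (intro completion_map_trans[where A = "R i" and B = "S j"]) simp_all
  next
    fix i m j assume ij: "i \<in> I" "m \<in> I" "j \<in> J" "R m \<subseteq> S j" "i \<le> m"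
    then show "R i \<subseteq> S j" using dominates_subset[OF domR] by blast
    fix x assume "x \<in> carrier (completion_of K (R i))"
    with ij show "completion_of_map K (S j) (completion_of_map K (R m) x) = completion_of_map K (S j) x"
      using locR locS domRS domR by (intro completion_map_trans[where A = "R i" and B = "R m"]) simp_all
  next
    fix j i m assume "j \<in> J" "i \<in> I" "m \<in> I" "S j \<subseteq> R i" "i \<le> m"
    then show "S j \<subseteq> R m" using dominates_subset[OF domR] by blast
  next
    fix i j m x
    assume "i \<in> I" "j \<in> J" "m \<in> I" "R i \<subseteq> S j" "S j \<subseteq> R m"
      "x \<in> carrier (completion_of K (R i))"
    then show "completion_of_map K (R m) (completion_of_map K (S j) x) = completion_of_map K (R m) x"
      using locR locS domRS domSR by (intro completion_map_trans[where A = "R i" and B = "S j"]) simp_all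
  next
    fix j i l y
    assume "j \<in> J" "i \<in> I" "l \<in> J" "S j \<subseteq> R i" "R i \<subseteq> S l"
      "y \<in> carrier (completion_of K (S j))"
    then show "completion_of_map K (S l) (completion_of_map K (R i) y) = completion_of_map K (S l) y"
      using locR locS domRS domSR by (intro completion_map_trans[where A = "S j" and B = "R i"]) simp_all
  next
    show "\<exists>j \<in> J. R i \<subseteq> S j" if "i \<in> I" for i
      using cofinal(1)[OF that] dominates_subset by blast
    show "\<exists>i \<in> I. S j \<subseteq> R i" if "j \<in> J" for j
      using cofinal(2)[OF that] dominates_subset by blast
  qed (use locR locS domRS domSR in \<open>auto intro: completion_map_hom\<close>)
  then show ?thesis using cofinal by (intro conjI ballI)
qed

end
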